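(* Consider the hyperbolic-parabolic system $$\partial_t u+\sum_{j=1}^d a_j(u)\,\partial_{x_j}u=\sum_{j=1}^d\partial_{x_j}\Big(\sum_{k=1}^d D_{jk}(u)\,\partial_{x_k}u\Big),\qquad u=(u_1,u_2)^T\in\Omega_u\subset\mathbb R^m,\ u_1\in\mathbb R^{m-s},\ u_2\in\mathbb R^s,$$ where $a_j=\begin{pmatrix} a_j^{11} & a_j^{12} \\ a_j^{21} & a_j^{22} \end{pmatrix}$ and $D_{jk}=\begin{pmatrix} 0 & 0 \\ D_{jk}^{21} & D_{jk}^{22} \end{pmatrix}$ are smooth $m\times m$-matrix valued functions of $u$, partitioned according to $m=(m-s)+s$. Assume there is a smooth symmetric positive definite matrix function $a_0=a_0(u)$ such that for all $u\in\Omega_u$: (I) $a_0a_j$ is symmetric for all $j=1,\dots,d$; (II) the $md\times md$ block matrix $(a_0D_{jk})_{j,k=1}^d$ is symmetric positive semidefinite; (III) the $sd\times sd$ block matrix $H=(D_{jk}^{22})_{j,k=1}^d$ is invertible. Then the relaxation system for $U=(u_1,u_2,w_1,\dots,w_d)^T\in\mathbb R^{m+sd}$, $w_j\in\mathbb R^s$, $$\begin{aligned} &\partial_tu_1+\sum_{j=1}^d a_j^{11}\partial_{x_j}u_1+\sum_{j=1}^d a_j^{12}\partial_{x_j}u_2=0, \\ &\partial_tu_2+\sum_{j=1}^d a_j^{21}\partial_{x_j}u_1+\sum_{j=1}^d a_j^{22}\partial_{x_j}u_2+\frac1\varepsilon\sum_{j=1}^d\partial_{x_j}w_j=0, \\ &\partial_tw_j+\frac1\varepsilon\Big(\sum_{k=1}^d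 D_{jk}^{21}\partial_{x_k}u_1+\sum_{k=1}^d D_{jk}^{22}\partial_{x_k}u_2\Big)=-\frac1{\varepsilon^2}w_j,\quad j=1,\dots,d,\end{aligned}$$ written in the form $\partial_tU+\frac1\varepsilon\sum_jA_j(U;\varepsilon)\partial_{x_j}U=\frac1{\varepsilon^2}Q(U;\varepsilon)$ with $u=(u_1,u_2)$ and $w=(w_1,\dots,w_d)$, satisfies the convergence criteria (i)-(v) listed in the context.
   Context: Convergence criteria. Let $\partial_tU+\frac1\varepsilon\sum_{j=1}^dA_j(U;\varepsilon)\partial_{x_j}U=\frac1{\varepsilon^2}Q(U;\varepsilon)$ be a first-order system for $U=(u,w)^T\in\Omega\subset\mathbb R^n$, $u\in\mathbb R^{n-r}$, $w\in\mathbb R^r$, with parameter $\varepsilon\in(0,1]$; $A_j$ and $Q$ are smooth in $(U;\varepsilon)$, up to $\varepsilon=0$. $\Omega_u\subset\mathbb R^{n-r}$ is an open convex set (the state space of $u$), $\Omega$ is open, $(u,w)\in\Omega$ implies $u\in\Omega_u$, and $(u,0)\in\Omega$ for $u\in\Omega_u$. An $n\times n$ matrix $A$ is partitioned as $\begin{pmatrix} A^{11} & A^{12} \\ A^{21} & A^{22} \end{pmatrix}$ according to $n=(n-r)+r$. The convergence criteria are: (i) $Q(U;\varepsilon)=(0,q(U;\varepsilon))^T$ with $q$ a smooth $\mathbb R^r$-valued function. (ii) $q(u,w;0)=0$ if and only if $w=0$, and $\partial_wq(u,0;0)$ is invertible for all $u\in\Omega_u$. (iii) There is a symmetric positive definite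 matrix $A_0(U;\varepsilon)$ (symmetrizer) such that $A_0(U;\varepsilon)A_j(U;\varepsilon)=A_j(U;\varepsilon)^TA_0(U;\varepsilon)$ for all $U\in\Omega$ and all $j$. (iv) With this $A_0$, there is a symmetric positive definite $r\times r$ matrix $S(u)$ such that $A_0(u,0;0)\,\partial_UQ(u,0;0)+(\partial_UQ(u,0;0))^TA_0(u,0;0)\le-\begin{pmatrix} 0 & 0 \\ 0 & S(u) \end{pmatrix}$ for all $u\in\Omega_u$. (v) $A_j^{11}(u,0;0)=0$ and $\partial_uA_j^{11}(u,0;0)=0$ for all $u\in\Omega_u$ and all $j$. For the system in the claim, $n=m+sd$, $r=sd$, $n-r=m$, and none of the coefficient matrices depends on $w$. *)

theory Defs
  imports "HOL-Analysis.Analysis"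
begin

section \<open>Smoothness\<close>

text \<open>
  On an open subset of a Euclidean space \<open>Ck_on k f\<close> is the usual \<open>k\<close>-fold continuous
  differentiability: the iterated directional derivatives of \<open>f\<close> up to order \<open>k\<close> exist and are
  continuous.
\<close>

fun Ck_on :: "nat \<Rightarrow> ('a::real_normed_vector \<Rightarrow> 'b::real_normed_vector) \<Rightarrow> 'a set \<Rightarrow> bool" where
  "Ck_on 0 f S \<longleftrightarrow> continuous_on S f"
| "Ck_on (Suc k) f S \<longleftrightarrow>
     (\<forall>x\<in>S. f differentiable (at x)) \<and> (\<forall>v. Ck_on k (\<lambda>x. frechet_derivative f (at x) v) S)"

text \<open>
  Smoothness on an arbitrary set means existence of a smooth extension to an open neighbourhood; on
  an open set this is plain smoothness. The general form is needed for functions of \<open>(U; \<epsilon>)\<close> that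
  are smooth up to the boundary value \<open>\<epsilon> = 0\<close>.
\<close>

definition smooth_on :: "'a::real_normed_vector set \<Rightarrow> ('a \<Rightarrow> 'b::real_normed_vector) \<Rightarrow> bool" where
  "smooth_on S f \<longleftrightarrow>
     (\<exists>T g. open T \<and> S \<subseteq> T \<and> (\<forall>x\<in>S. g x = f x) \<and> (\<forall>k. Ck_on k g T))"


section \<open>Matrices and block structure\<close>

definition sym_pos_def :: "real^'n^'n \<Rightarrow> bool" where
  "sym_pos_def M \<longleftrightarrow> transpose M = M \<and> (\<forall>x. x \<noteq> 0 \<longrightarrow> 0 < x \<bullet> (M *v x))"

definition sym_pos_semidef :: "real^'n^'n \<Rightarrow> bool" where
  "sym_pos_semidef M \<longleftrightarrow> transpose M = M \<and> (\<forall>x. 0 \<le> x \<bullet> (M *v x))"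

text \<open>The order on symmetric matrices.\<close>

definition loewner_le :: "real^'n^'n \<Rightarrow> real^'n^'n \<Rightarrow> bool" where
  "loewner_le M N \<longleftrightarrow> sym_pos_semidef (N - M)"

text \<open>
  A state \<open>U = (u, w)\<close> is indexed by a sum type: \<open>'k\<close> indexes \<open>u\<close> (so \<open>n - r = CARD('k)\<close>) and
  \<open>'r\<close> indexes \<open>w\<close>.
\<close>

definition join :: "real^'k \<Rightarrow> real^'r \<Rightarrow> real^('k::finite + 'r::finite)" where
  "join u w = (\<chi> i. case i of Inl a \<Rightarrow> u $ a | Inr b \<Rightarrow> w $ b)"

definition u_part :: "real^('k::finite + 'r::finite) \<Rightarrow> real^'k" where
  "u_part U = (\<chi> a. U $ Inl a)"

definition block_mat ::
  "real^'k^'k \<Rightarrow> real^'r^'k \<Rightarrow> real^'k^'r \<Rightarrow> real^'r^'r \<Rightarrow> real^('k::finite + 'r::finite)^('k + 'r)" where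
  "block_mat M11 M12 M21 M22 =
     (\<chi> i j. case i of
        Inl a \<Rightarrow> (case j of Inl c \<Rightarrow> M11 $ a $ c | Inr e \<Rightarrow> M12 $ a $ e)
      | Inr b \<Rightarrow> (case j of Inl c \<Rightarrow> M21 $ b $ c | Inr e \<Rightarrow> M22 $ b $ e))"

definition block11 :: "real^('k::finite + 'r::finite)^('k + 'r) \<Rightarrow> real^'k^'k" where
  "block11 M = (\<chi> a c. M $ Inl a $ Inl c)"


section \<open>Systems with a small parameter and the convergence criteria\<close>

definition dt :: "(real \<Rightarrow> real^'d \<Rightarrow> real^'n) \<Rightarrow> real \<Rightarrow> real^'d \<Rightarrow> real^'n" where
  "dt f t x = vector_derivative (\<lambda>\<tau>. f \<tau> x) (at t)"

definition dx :: "'d \<Rightarrow> (real \<Rightarrow> real^'d \<Rightarrow> real^'n) \<Rightarrow> real \<Rightarrow> real^'d \<Rightarrow> real^'n" where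
  "dx j f t x = vector_derivative (\<lambda>h. f t (x + h *\<^sub>R axis j 1)) (at 0)"

text \<open>\<open>U\<close> satisfies \<open>\<partial>\<^sub>t U + (1/\<epsilon>) \<Sum>\<^sub>j A\<^sub>j(U; \<epsilon>) \<partial>\<^sub>j U = (1/\<epsilon>\<^sup>2) Q(U; \<epsilon>)\<close> at the point \<open>(t, x)\<close>.\<close>

definition solves_system_at ::
  "('d::finite \<Rightarrow> real^'n \<Rightarrow> real \<Rightarrow> real^'n^'n) \<Rightarrow> (real^'n \<Rightarrow> real \<Rightarrow> real^'n) \<Rightarrow> real \<Rightarrow>
   (real \<Rightarrow> real^'d \<Rightarrow> real^'n) \<Rightarrow> real \<Rightarrow> real^'d \<Rightarrow> bool" where
  "solves_system_at A Q \<epsilon> U t x \<longleftrightarrow>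
     dt U t x + (1 / \<epsilon>) *\<^sub>R (\<Sum>j\<in>UNIV. A j (U t x) \<epsilon> *v dx j U t x) =
     (1 / \<epsilon>\<^sup>2) *\<^sub>R Q (U t x) \<epsilon>"

definition state_spaces :: "(real^'k) set \<Rightarrow> (real^('k::finite + 'r::finite)) set \<Rightarrow> bool" where
  "state_spaces \<Omega>u \<Omega> \<longleftrightarrow>
     open \<Omega>u \<and> convex \<Omega>u \<and> open \<Omega> \<and>
     (\<forall>u w. join u w \<in> \<Omega> \<longrightarrow> u \<in> \<Omega>u) \<and> (\<forall>u\<in>\<Omega>u. join u 0 \<in> \<Omega>)"

definition smooth_coefficients ::
  "(real^'n) set \<Rightarrow> ('d \<Rightarrow> real^'n \<Rightarrow> real \<Rightarrow> real^'n^'n) \<Rightarrow>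
   (real^'n \<Rightarrow> real \<Rightarrow> real^'n) \<Rightarrow> bool" where
  "smooth_coefficients \<Omega> A Q \<longleftrightarrow>
     (\<forall>j. smooth_on (\<Omega> \<times> {0..1}) (\<lambda>(U, \<epsilon>). A j U \<epsilon>)) \<and>
     smooth_on (\<Omega> \<times> {0..1}) (\<lambda>(U, \<epsilon>). Q U \<epsilon>)"

text \<open>
  In order: the form of \<open>Q\<close>; the equilibria; the symmetrizer \<open>A0\<close>, which is required to depend
  smoothly on \<open>(U; \<epsilon>)\<close>; the dissipation inequality; the vanishing of \<open>A\<^sub>j\<^sup>1\<^sup>1(u,0;0)\<close> and of
  its \<open>u\<close>-derivative. No regularity of \<open>S\<close> in \<open>u\<close> is asked for.
\<close>

definition convergence_criteria ::
  "(real^'k) set \<Rightarrow> (real^('k::finite + 'r::finite)) set \<Rightarrow>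
   ('d \<Rightarrow> real^('k + 'r) \<Rightarrow> real \<Rightarrow> real^('k + 'r)^('k + 'r)) \<Rightarrow>
   (real^('k + 'r) \<Rightarrow> real \<Rightarrow> real^('k + 'r)) \<Rightarrow> bool" where
  "convergence_criteria \<Omega>u \<Omega> A Q \<longleftrightarrow>
     (\<exists>(q :: real^('k + 'r) \<Rightarrow> real \<Rightarrow> real^'r)
       (A0 :: real^('k + 'r) \<Rightarrow> real \<Rightarrow> real^('k + 'r)^('k + 'r))
       (S :: real^'k \<Rightarrow> real^'r^'r).
       (smooth_on (\<Omega> \<times> {0..1}) (\<lambda>(U, \<epsilon>). q U \<epsilon>) \<and>
        (\<forall>U\<in>\<Omega>. \<forall>\<epsilon>\<in>{0..1}. Q U \<epsilon> = join 0 (q U \<epsilon>))) \<and>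
       ((\<forall>u w. join u w \<in> \<Omega> \<longrightarrow> (q (join u w) 0 = 0 \<longleftrightarrow> w = 0)) \<and>
        (\<forall>u\<in>\<Omega>u. invertible (jacobian (\<lambda>w. q (join u w) 0) (at 0)))) \<and>
       (smooth_on (\<Omega> \<times> {0..1}) (\<lambda>(U, \<epsilon>). A0 U \<epsilon>) \<and>
        (\<forall>U\<in>\<Omega>. \<forall>\<epsilon>\<in>{0..1}. sym_pos_def (A0 U \<epsilon>) \<and>
           (\<forall>j. A0 U \<epsilon> ** A j U \<epsilon> = transpose (A j U \<epsilon>) ** A0 U \<epsilon>))) \<and>
       (\<forall>u\<in>\<Omega>u. sym_pos_def (S u) \<and>
          (let J = jacobian (\<lambda>U. Q U 0) (at (join u 0)) in
             loewner_le (A0 (join u 0) 0 ** J + transpose J ** A0 (join u 0) 0)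
                        (- block_mat 0 0 0 (S u)))) \<and>
       (\<forall>u\<in>\<Omega>u. \<forall>j. block11 (A j (join u 0) 0) = 0 \<and>
          ((\<lambda>v. block11 (A j (join v 0) 0)) has_derivative (\<lambda>_. 0)) (at u)))"


section \<open>The relaxation system of a hyperbolic-parabolic system\<close>

text \<open>
  The partition \<open>u = (u\<^sub>1, u\<^sub>2)\<close> of \<open>u :: real^'m\<close> is encoded by an injection \<open>\<iota> :: 's \<Rightarrow> 'm\<close> locating
  the components of \<open>u\<^sub>2\<close> among those of \<open>u\<close>; the components of \<open>u\<^sub>1\<close> are those outside
  \<open>range \<iota>\<close>. Unlike a sum type, this includes the case \<open>s = m\<close>, where \<open>u\<^sub>1\<close> is absent.
  The blocks \<open>D\<^sup>2\<^sup>1\<close>, \<open>D\<^sup>2\<^sup>2\<close> together are the rows of \<open>D\<close> in \<open>range \<iota>\<close>, and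
  \<open>D\<^sup>2\<^sup>2\<close> has the entries \<open>D $ \<iota> b $ \<iota> c\<close>. The vector \<open>w = (w\<^sub>1, \<dots>, w\<^sub>d)\<close> is indexed by
  \<open>'d \<times> 's\<close>, and \<open>md \<times> md\<close> block matrices by \<open>'d \<times> 'm\<close>.
\<close>

definition stack :: "('d \<Rightarrow> real^'s) \<Rightarrow> real^('d::finite \<times> 's::finite)" where
  "stack w = (\<chi> p. w (fst p) $ snd p)"

definition big_block :: "('d \<Rightarrow> 'd \<Rightarrow> real^'n^'n) \<Rightarrow> real^('d::finite \<times> 'n::finite)^('d \<times> 'n)" where
  "big_block M = (\<chi> p q. M (fst p) (fst q) $ snd p $ snd q)"

definition sub22 :: "('s \<Rightarrow> 'm) \<Rightarrow> real^'m^'m \<Rightarrow> real^'s^'s" where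
  "sub22 \<iota> M = (\<chi> b c. M $ \<iota> b $ \<iota> c)"

text \<open>
  The relaxation system at the point \<open>(t, x)\<close>: its first two conjuncts are the equations for \<open>u\<^sub>1\<close>
  and \<open>u\<^sub>2\<close>, written componentwise; in the equation for \<open>w\<^sub>j\<close>, the sum over \<open>l\<close> is the component \<open>b\<close>
  of \<open>D\<^sup>2\<^sup>1\<^sub>j\<^sub>k \<partial>\<^sub>k u\<^sub>1 + D\<^sup>2\<^sup>2\<^sub>j\<^sub>k \<partial>\<^sub>k u\<^sub>2\<close>.
\<close>

definition solves_relaxation_at ::
  "('s::finite \<Rightarrow> 'm::finite) \<Rightarrow> ('d::finite \<Rightarrow> real^'m \<Rightarrow> real^'m^'m) \<Rightarrow>
   ('d \<Rightarrow> 'd \<Rightarrow> real^'m \<Rightarrow> real^'m^'m) \<Rightarrow> real \<Rightarrow>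
   (real \<Rightarrow> real^'d \<Rightarrow> real^'m) \<Rightarrow> ('d \<Rightarrow> real \<Rightarrow> real^'d \<Rightarrow> real^'s) \<Rightarrow>
   real \<Rightarrow> real^'d \<Rightarrow> bool" where
  "solves_relaxation_at \<iota> a D \<epsilon> u w t x \<longleftrightarrow>
     (\<forall>i. i \<notin> range \<iota> \<longrightarrow>
        dt u t x $ i + (\<Sum>j\<in>UNIV. \<Sum>l\<in>UNIV. a j (u t x) $ i $ l * dx j u t x $ l) = 0) \<and>
     (\<forall>b. dt u t x $ \<iota> b
            + (\<Sum>j\<in>UNIV. \<Sum>l\<in>UNIV. a j (u t x) $ \<iota> b $ l * dx j u t x $ l)
            + (1 / \<epsilon>) * (\<Sum>j\<in>UNIV. dx j (w j) t x $ b) = 0) \<and>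
     (\<forall>j b. dt (w j) t x $ b
            + (1 / \<epsilon>) * (\<Sum>k\<in>UNIV. \<Sum>l\<in>UNIV. D j k (u t x) $ \<iota> b $ l * dx k u t x $ l)
          = - (1 / \<epsilon>\<^sup>2) * w j t x $ b)"

text \<open>
  The coefficients of the relaxation system in the form of \<open>solves_system_at\<close>. The prefactor
  \<open>1/\<epsilon>\<close> there turns \<open>a\<^sub>j\<close> into \<open>\<epsilon> a\<^sub>j\<close>.
\<close>

definition relax_A ::
  "('s::finite \<Rightarrow> 'm::finite) \<Rightarrow> ('d::finite \<Rightarrow> real^'m \<Rightarrow> real^'m^'m) \<Rightarrow>
   ('d \<Rightarrow> 'd \<Rightarrow> real^'m \<Rightarrow> real^'m^'m) \<Rightarrow>
   'd \<Rightarrow> real^('m + 'd \<times> 's) \<Rightarrow> real \<Rightarrow> real^('m + 'd \<times> 's)^('m + 'd \<times> 's)" where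
  "relax_A \<iota> a D j U \<epsilon> =
     block_mat (\<epsilon> *\<^sub>R a j (u_part U))
       (\<chi> i p. if fst p = j \<and> i = \<iota> (snd p) then 1 else 0)
       (\<chi> p l. D (fst p) j (u_part U) $ \<iota> (snd p) $ l)
       0"

definition relax_Q :: "real^('m::finite + 'd::finite \<times> 's::finite) \<Rightarrow> real \<Rightarrow> real^('m + 'd \<times> 's)" where
  "relax_Q U \<epsilon> = join 0 (- (\<chi> p. U $ Inr p))"

end

theory Submission
  imports Defs
begin

text \<open>
  The symmetrizer is \<open>A\<^sub>0 = diag(a\<^sub>0, M)\<close>, and symmetry of \<open>A\<^sub>0 A\<^sub>j\<close> amounts to
  \<open>M (D\<^sup>2\<^sup>1, D\<^sup>2\<^sup>2) = diag(a\<^sub>0\<^sup>2\<^sup>1, a\<^sub>0\<^sup>2\<^sup>2)\<close>, which forces \<open>M = diag(a\<^sub>0\<^sup>2\<^sup>2) H\<^sup>-\<^sup>1\<close>.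
  By (II), \<open>diag(a\<^sub>0\<^sup>2\<^sup>2) H\<close> is symmetric positive semidefinite, hence so is \<open>M\<close>; being invertible,
  \<open>M\<close> is positive definite, and the \<open>D\<^sup>2\<^sup>1\<close>-part of the identity is the symmetry of the off-diagonal
  blocks in (II). The source is linear with \<open>\<partial>\<^sub>U Q = diag(0, -1)\<close>, so the dissipation inequality
  holds with equality for \<open>S = 2 M\<close>.
\<close>

section \<open>Calculus of smooth functions\<close>

lemma Ck_on_continuous: "Ck_on k f S \<Longrightarrow> continuous_on S f"
  by (cases k) (auto intro!: continuous_at_imp_continuous_on differentiable_imp_continuous_within)

text \<open>Order \<open>Suc k\<close> does not contain order \<open>k\<close> as a conjunct. The
  descent passes through the derivatives, and at the bottom differentiability gives
  continuity.\<close>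

lemma Ck_on_Suc_imp: "Ck_on (Suc k) f S \<Longrightarrow> Ck_on k f S"
proof (induction k arbitrary: f)
  case 0
  then show ?case by (metis Ck_on.simps(1) Ck_on_continuous)
next
  case (Suc k)
  have "f differentiable (at x)" if "x \<in> S" for x
    using Suc.prems that unfolding Ck_on.simps(2)[of "Suc k"] by blast
  moreover have "Ck_on k (\<lambda>x. frechet_derivative f (at x) v) S" for v
    using Suc.prems Suc.IH unfolding Ck_on.simps(2)[of "Suc k"] by blast
  ultimately show ?case by simp
qed

lemma Ck_on_subset: "Ck_on k f S \<Longrightarrow> T \<subseteq> S \<Longrightarrow> Ck_on k f T"
  by (induction k arbitrary: f) (auto intro: continuous_on_subset)

text \<open>On an open set, equality of functions passes to their derivatives, since derivatives are
  local and unique, and hence to every order.\<close>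

lemma Ck_on_cong:
  assumes "open S" "\<And>x. x \<in> S \<Longrightarrow> f x = g x" "Ck_on k f S"
  shows "Ck_on k g S"
  using assms(2,3)
proof (induction k arbitrary: f g)
  case 0
  then show ?case by (auto cong: continuous_on_cong_simp)
next
  case (Suc k)
  have d: "(g has_derivative frechet_derivative f (at x)) (at x)" if "x \<in> S" for x
    by (rule has_derivative_transform_within_open[where f = f, OF _ assms(1) that])
       (use Suc.prems that in \<open>auto simp: frechet_derivative_works[symmetric]\<close>)
  have e: "frechet_derivative g (at x) = frechet_derivative f (at x)" if "x \<in> S" for x
    using frechet_derivative_at[OF d[OF that]] by simp
  show ?case
    using d Suc.IH[of "\<lambda>x. frechet_derivative f (at x) _" "\<lambda>x. frechet_derivative g (at x) _"] Suc.prems(2)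
    by (auto simp: e differentiable_def)
qed

text \<open>Replaces the chosen \<open>frechet_derivative\<close> by any explicitly known
  derivative, so that closure properties follow from the usual differentiation rules.\<close>

lemma Ck_on_SucI:
  assumes "open S" "\<And>x. x \<in> S \<Longrightarrow> (f has_derivative f' x) (at x)" "\<And>v. Ck_on k (\<lambda>x. f' x v) S"
  shows "Ck_on (Suc k) f S"
proof -
  have "frechet_derivative f (at x) = f' x" if "x \<in> S" for x
    using frechet_derivative_at[OF assms(2)[OF that]] by simp
  then have "Ck_on k (\<lambda>x. frechet_derivative f (at x) v) S" for v
    by (intro Ck_on_cong[OF assms(1) _ assms(3)[of v]]) simp
  then show ?thesis using assms(2) by (auto simp: differentiable_def)
qed

lemma Ck_on_SucD:
  assumes "Ck_on (Suc k) f S" "x \<in> S"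
  shows "(f has_derivative frechet_derivative f (at x)) (at x)"
  using assms by (simp add: frechet_derivative_works)

lemma Ck_on_const: "open S \<Longrightarrow> Ck_on k (\<lambda>x. c) S"
proof (induction k arbitrary: c)
  case (Suc k)
  then show ?case by (auto intro!: Ck_on_SucI[where f' = "\<lambda>_ _. 0"])
qed simp

lemma Ck_on_bounded_linear:
  assumes "open S" "bounded_linear L"
  shows "Ck_on k L S"
proof (cases k)
  case 0
  then show ?thesis using assms by (simp add: linear_continuous_on)
next
  case (Suc k')
  show ?thesis
    unfolding Suc
    by (rule Ck_on_SucI[where f' = "\<lambda>_. L"])
       (use assms in \<open>auto intro: Ck_on_const bounded_linear_imp_has_derivative\<close>)
qed

lemma Ck_on_add:
  assumes "open S" "Ck_on k f S" "Ck_on k g S"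
  shows "Ck_on k (\<lambda>x. f x + g x) S"
  using assms(2,3)
proof (induction k arbitrary: f g)
  case 0
  then show ?case by (simp add: continuous_on_add)
next
  case (Suc k)
  show ?case
    by (rule Ck_on_SucI[OF assms(1) has_derivative_add[OF Ck_on_SucD[OF Suc.prems(1)] Ck_on_SucD[OF Suc.prems(2)]]])
       (use Suc in auto)
qed

lemma Ck_on_sum:
  assumes "open S" "\<And>i. i \<in> I \<Longrightarrow> Ck_on k (f i) S"
  shows "Ck_on k (\<lambda>x. \<Sum>i\<in>I. f i x) S"
  using assms(2) by (induction I rule: infinite_finite_induct) (auto simp: assms(1) Ck_on_const Ck_on_add)

lemma Ck_on_linear_compose:
  assumes "open S" "bounded_linear L" "Ck_on k f S"
  shows "Ck_on k (\<lambda>x. L (f x)) S"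
  using assms(3)
proof (induction k arbitrary: f)
  case 0
  then show ?case by (simp add: assms(2) bounded_linear.continuous_on)
next
  case (Suc k)
  show ?case
    by (rule Ck_on_SucI[OF assms(1) bounded_linear.has_derivative[OF assms(2) Ck_on_SucD[OF Suc.prems]]])
       (use Suc in auto)
qed

text \<open>For linear \<open>L\<close> the derivative of the composition in direction
  \<open>v\<close> is the derivative of \<open>f\<close> in the fixed direction \<open>L v\<close>,
  again composed with \<open>L\<close>. The induction therefore closes without a product
  rule.\<close>

lemma Ck_on_compose_linear:
  assumes "open S" "bounded_linear L" "Ck_on k f T" "L ` S \<subseteq> T"
  shows "Ck_on k (\<lambda>x. f (L x)) S"
  using assms(3)
proof (induction k arbitrary: f)
  case 0
  then show ?case using assms
    by (auto intro!: continuous_on_compose2[of T f S L] simp: linear_continuous_on)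
next
  case (Suc k)
  have "((\<lambda>x. f (L x)) has_derivative (\<lambda>v. frechet_derivative f (at (L x)) (L v))) (at x)" if "x \<in> S" for x
    by (rule has_derivative_compose[OF bounded_linear_imp_has_derivative[OF assms(2)] Ck_on_SucD[OF Suc.prems]])
       (use assms(4) that in auto)
  then show ?case
    by (rule Ck_on_SucI[OF assms(1)]) (use Suc in auto)
qed

text \<open>The product rule leaves one factor undifferentiated in each summand, so the induction
  also needs \<open>f\<close> and \<open>g\<close> themselves at the lower order.\<close>

lemma Ck_on_mult:
  fixes f g :: "'a::real_normed_vector \<Rightarrow> real"
  assumes "open S" "Ck_on k f S" "Ck_on k g S"
  shows "Ck_on k (\<lambda>x. f x * g x) S"
  using assms(2,3)
proof (induction k arbitrary: f g)
  case 0
  then show ?case by (simp add: continuous_on_mult)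
next
  case (Suc k)
  have "Ck_on k f S" "Ck_on k g S"
    using Suc.prems by (simp_all only: Ck_on_Suc_imp)
  then have "Ck_on k (\<lambda>x. f x * frechet_derivative g (at x) v + frechet_derivative f (at x) v * g x) S" for v
    using Suc.prems by (intro Ck_on_add Suc.IH assms(1)) simp_all
  then show ?case
    by (intro Ck_on_SucI[OF assms(1) has_derivative_mult[OF Ck_on_SucD[OF Suc.prems(1)] Ck_on_SucD[OF Suc.prems(2)]]])
qed

lemma Ck_on_prod:
  fixes f :: "'i \<Rightarrow> 'a::real_normed_vector \<Rightarrow> real"
  assumes "open S" "\<And>i. i \<in> I \<Longrightarrow> Ck_on k (f i) S"
  shows "Ck_on k (\<lambda>x. \<Prod>i\<in>I. f i x) S"
  using assms(2) by (induction I rule: infinite_finite_induct) (auto simp: assms(1) Ck_on_const Ck_on_mult)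

text \<open>The derivative of the reciprocal is a product in which the reciprocal occurs again, but
  only at the lower order, where the induction hypothesis covers it.\<close>

lemma Ck_on_inverse:
  fixes f :: "'a::real_normed_vector \<Rightarrow> real"
  assumes "open S" "Ck_on k f S" "\<And>x. x \<in> S \<Longrightarrow> f x \<noteq> 0"
  shows "Ck_on k (\<lambda>x. inverse (f x)) S"
  using assms(2)
proof (induction k)
  case 0
  then show ?case using assms(3) by (simp add: continuous_on_inverse)
next
  case (Suc k)
  have *: "Ck_on k (\<lambda>x. inverse (f x)) S"
    by (rule Suc.IH[OF Ck_on_Suc_imp[OF Suc.prems]])
  show ?case
  proof (rule Ck_on_SucI[OF assms(1)])
    show "((\<lambda>x. inverse (f x)) has_derivative
        (\<lambda>v. (-1) * (inverse (f x) * frechet_derivative f (at x) v * inverse (f x)))) (at x)" if "x \<in> S" for x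
      using Deriv.has_derivative_inverse[OF assms(3)[OF that] Ck_on_SucD[OF Suc.prems that]] by simp
    show "Ck_on k (\<lambda>x. (-1) * (inverse (f x) * frechet_derivative f (at x) v * inverse (f x))) S" for v
      by (intro Ck_on_mult Ck_on_const * assms(1)) (use Suc.prems in simp)
  qed
qed

section \<open>Smoothness of vector- and matrix-valued functions, up to the matrix inverse\<close>

lemma bounded_linear_axis: "bounded_linear (axis i :: 'b::euclidean_space \<Rightarrow> 'b^'n)"
  by (simp add: linear_conv_bounded_linear[symmetric] linear_iff vec_eq_iff axis_def)

lemma sum_axis_nth: "(\<Sum>i\<in>UNIV. axis i (x $ i)) = x"
  by (simp add: vec_eq_iff axis_def sum.delta)

text \<open>A vector is the finite sum of its components embedded linearly by \<open>axis\<close>,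
  so closure under sums and linear maps suffices.\<close>

lemma Ck_on_vec:
  fixes f :: "'a::real_normed_vector \<Rightarrow> 'b::euclidean_space^'n"
  assumes "open S" "\<And>i. Ck_on k (\<lambda>x. f x $ i) S"
  shows "Ck_on k f S"
proof -
  have "Ck_on k (\<lambda>x. \<Sum>i\<in>UNIV. axis i (f x $ i)) S"
    by (intro Ck_on_sum Ck_on_linear_compose[where L = "axis _"] bounded_linear_axis assms)
  then show ?thesis by (simp add: sum_axis_nth)
qed

lemma Ck_on_vec_nth:
  fixes f :: "'a::real_normed_vector \<Rightarrow> 'b::real_normed_vector^'n"
  assumes "open S" "Ck_on k f S"
  shows "Ck_on k (\<lambda>x. f x $ i) S"
  by (rule Ck_on_linear_compose[OF assms(1) bounded_linear_vec_nth assms(2)])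

lemma Ck_on_matrix_mult:
  fixes F :: "'a::real_normed_vector \<Rightarrow> real^'n^'m" and G :: "'a \<Rightarrow> real^'p^'n"
  assumes "open S" "Ck_on k F S" "Ck_on k G S"
  shows "Ck_on k (\<lambda>x. F x ** G x) S"
  by (rule Ck_on_vec[OF assms(1)], rule Ck_on_vec[OF assms(1)])
     (simp add: matrix_matrix_mult_def, intro Ck_on_sum Ck_on_mult Ck_on_vec_nth assms)

lemma Ck_on_det:
  fixes F :: "'a::real_normed_vector \<Rightarrow> real^'n^'n"
  assumes "open S" "Ck_on k F S"
  shows "Ck_on k (\<lambda>x. det (F x)) S"
  unfolding det_def by (intro Ck_on_sum Ck_on_mult Ck_on_prod Ck_on_const Ck_on_vec_nth assms)

lemma matrix_inv:
  fixes A :: "real^'n^'n"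
  assumes "invertible A"
  shows "A ** matrix_inv A = mat 1" "matrix_inv A ** A = mat 1"
  using someI_ex[OF assms[unfolded invertible_def]] unfolding matrix_inv_def by blast+

text \<open>By Cramer's rule each entry of the inverse is a quotient of determinants whose
  denominator does not vanish on \<open>S\<close>.\<close>

lemma Ck_on_matrix_inv:
  fixes F :: "'a::real_normed_vector \<Rightarrow> real^'n^'n"
  assumes "open S" "Ck_on k F S" "\<And>x. x \<in> S \<Longrightarrow> invertible (F x)"
  shows "Ck_on k (\<lambda>x. matrix_inv (F x)) S"
proof -
  \<comment> \<open>Column \<open>i\<close> of \<open>F x\<close> is replaced by the
    \<open>j\<close>-th unit vector. This is the Cramer numerator for entry \<open>(i, j)\<close>,
    because column \<open>j\<close> of the inverse solves
    \<open>F x *v y = axis j 1\<close>.\<close>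
  define C where "C = (\<lambda>x i j. (\<chi> r c. if c = i then axis j 1 $ r else F x $ r $ c) :: real^'n^'n)"
  have eq: "det (C x i j) * inverse (det (F x)) = matrix_inv (F x) $ i $ j" if "x \<in> S" for x i j
  proof -
    have inv: "F x ** matrix_inv (F x) = mat 1" "det (F x) \<noteq> 0"
      using assms(3)[OF that] matrix_inv(1) invertible_det_nz by blast+
    then have "F x *v (matrix_inv (F x) *v axis j 1) = axis j 1"
      by (simp add: matrix_vector_mul_assoc)
    then have "matrix_inv (F x) *v axis j 1 = (\<chi> i. det (C x i j) / det (F x))"
      unfolding C_def using cramer[OF inv(2)] by blast
    then have "(matrix_inv (F x) *v axis j 1) $ i = det (C x i j) / det (F x)" by simp
    then show ?thesis by (simp add: matrix_vector_mul_component inner_axis divide_inverse)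
  qed
  have "Ck_on k (\<lambda>x. if c = i then axis j 1 $ r else F x $ r $ c) S" for i j r c :: 'n
    by (cases "c = i") (simp_all add: Ck_on_const Ck_on_vec_nth assms)
  then have C: "Ck_on k (\<lambda>x. C x i j) S" for i j
    unfolding C_def by (intro Ck_on_vec[OF assms(1)]) simp
  have "det (F x) \<noteq> 0" if "x \<in> S" for x
    using assms(3)[OF that] invertible_det_nz by blast
  then have quot: "Ck_on k (\<lambda>x. det (C x i j) * inverse (det (F x))) S" for i j
    by (intro Ck_on_mult Ck_on_inverse Ck_on_det C assms(1,2))
  have "Ck_on k (\<lambda>x. matrix_inv (F x) $ i $ j) S" for i j
    by (rule Ck_on_cong[OF assms(1) eq quot])
  then show ?thesis
    by (intro Ck_on_vec[OF assms(1)])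
qed

section \<open>From \<open>Ck_on\<close> at every order to \<open>smooth_on\<close>\<close>

lemma smooth_on_open:
  assumes "open S"
  shows "smooth_on S f \<longleftrightarrow> (\<forall>k. Ck_on k f S)"
proof
  assume "smooth_on S f"
  then obtain T g where T: "S \<subseteq> T" "\<And>x. x \<in> S \<Longrightarrow> g x = f x" "\<And>k. Ck_on k g T"
    unfolding smooth_on_def by blast
  show "\<forall>k. Ck_on k f S"
  proof
    show "Ck_on k f S" for k by (rule Ck_on_cong[OF assms T(2) Ck_on_subset[OF T(3,1)]])
  qed
qed (use assms in \<open>auto simp: smooth_on_def\<close>)

lemma smooth_on_mono:
  assumes "smooth_on T f" "S \<subseteq> T"
  shows "smooth_on S f"
proof -
  obtain V g where "open V" "T \<subseteq> V" "\<forall>x\<in>T. g x = f x" "\<forall>k. Ck_on k g V"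
    using assms(1) unfolding smooth_on_def by blast
  then have "open V \<and> S \<subseteq> V \<and> (\<forall>x\<in>S. g x = f x) \<and> (\<forall>k. Ck_on k g V)"
    using assms(2) by auto
  then show ?thesis unfolding smooth_on_def by (intro exI)
qed

section \<open>Positive definite matrices\<close>

text \<open>If the form vanishes at \<open>x \<noteq> 0\<close>, then \<open>y = M *v x\<close> is
  nonzero by invertibility. Moving from \<open>x\<close> to \<open>x - t y\<close> changes the form
  by \<open>- 2 t (y \<bullet> y)\<close> to first order, which makes it negative for small
  \<open>t > 0\<close>.\<close>

lemma sym_pos_def_of_semidef:
  fixes M :: "real^'n^'n"
  assumes "sym_pos_semidef M" "invertible M"
  shows "sym_pos_def M"
proof -
  have sym: "transpose M = M" and nonneg: "\<And>x. 0 \<le> x \<bullet> (M *v x)"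
    using assms(1) by (auto simp: sym_pos_semidef_def)
  have "0 < x \<bullet> (M *v x)" if "x \<noteq> 0" for x
  proof (rule ccontr)
    assume "\<not> ?thesis"
    then have 0: "x \<bullet> (M *v x) = 0"
      using nonneg[of x] by simp
    define y where "y = M *v x"
    define c where "c = y \<bullet> (M *v y)"
    have "matrix_inv M *v y = x"
      unfolding y_def by (simp add: matrix_vector_mul_assoc matrix_inv assms(2))
    with that have "y \<noteq> 0" by auto
    then have yy: "0 < y \<bullet> y" by simp
    have xMy: "x \<bullet> (M *v y) = y \<bullet> y"
      using dot_lmul_matrix[of x M y] sym by (simp add: y_def flip: transpose_matrix_vector)
    have quad: "2 * t * (y \<bullet> y) \<le> t\<^sup>2 * c" for t
    proof -
      have "(x - t *\<^sub>R y) \<bullet> (M *v (x - t *\<^sub>R y)) = - (2 * t * (y \<bullet> y)) + t\<^sup>2 * c"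
        using 0 xMy by (simp add: matrix_vector_mult_diff_distrib matrix_vector_mult_scaleR inner_diff_left
            inner_diff_right c_def power2_eq_square algebra_simps flip: y_def)
      then show ?thesis using nonneg[of "x - t *\<^sub>R y"] by simp
    qed
    \<comment> \<open>The minimum of the quadratic is at \<open>t = (y \<bullet> y) / c\<close>; the shift avoids the case \<open>c = 0\<close>.\<close>
    define s where "s = (y \<bullet> y) / (c + 1)"
    have "0 \<le> c" unfolding c_def by (rule nonneg)
    then have s: "0 < s" "s * (c + 1) = y \<bullet> y"
      using yy by (simp_all add: s_def)
    have "s\<^sup>2 * c \<le> s\<^sup>2 * (c + 1)"
      by (intro mult_left_mono) auto
    also have "\<dots> = s * (y \<bullet> y)"
      using s(2) by (simp add: power2_eq_square mult.assoc)
    also have "\<dots> < 2 * s * (y \<bullet> y)"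
      using mult_pos_pos[OF s(1) yy] by simp
    finally show False using quad[of s] by simp
  qed
  then show ?thesis using sym by (simp add: sym_pos_def_def)
qed

lemma invertible_if_kernel_zero:
  fixes A :: "real^'n^'n"
  assumes "\<And>x. A *v x = 0 \<Longrightarrow> x = 0"
  shows "invertible A"
  using assms matrix_left_invertible_ker[of A] invertible_left_inverse by blast

lemma invertible_matrix_inv:
  fixes A :: "real^'n^'n"
  assumes "invertible A"
  shows "invertible (matrix_inv A)"
  unfolding invertible_def using matrix_inv[OF assms] by blast

text \<open>
  With \<open>G = R E\<close> and \<open>H = T E\<close>, the symmetry of \<open>R\<^sup>T T\<close> gives \<open>G T = H\<^sup>T R\<close> and hence
  \<open>G H\<^sup>-\<^sup>1 = H\<^sup>-\<^sup>T G\<close>; positivity is read off at \<open>x = T E H\<^sup>-\<^sup>1 x\<close>.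
\<close>

lemma symmetrizer_block:
  fixes R T :: "real^'q^'p" and E :: "real^'p^'q"
  assumes "sym_pos_semidef (transpose R ** T)"
    and symG: "transpose (R ** E) = R ** E"
    and invG: "invertible (R ** E)" and invH: "invertible (T ** E)"
  shows "sym_pos_def (R ** E ** matrix_inv (T ** E))" and "R ** E ** matrix_inv (T ** E) ** T = R"
proof -
  define G where "G = R ** E"
  define H where "H = T ** E"
  define N where "N = matrix_inv H"
  have HN: "H ** N = mat 1" "N ** H = mat 1"
    using matrix_inv[OF invH] by (auto simp: N_def H_def)
  then have NH': "transpose N ** transpose H = mat 1"
    by (metis matrix_transpose_mul transpose_mat)
  have symB: "transpose R ** T = transpose T ** R"
    using assms(1) by (simp add: sym_pos_semidef_def matrix_transpose_mul)
  have "transpose G ** T = transpose E ** (transpose R ** T)"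
    by (simp add: G_def matrix_transpose_mul matrix_mul_assoc)
  also have "\<dots> = transpose H ** R"
    unfolding symB by (simp add: H_def matrix_transpose_mul matrix_mul_assoc)
  finally have GT: "G ** T = transpose H ** R"
    using symG by (simp add: G_def)
  \<comment> \<open>Right multiplication of \<open>GT\<close> by \<open>E\<close>.\<close>
  then have GH: "G ** H = transpose H ** G"
    unfolding G_def H_def by (metis matrix_mul_assoc)
  have eq: "G ** N = transpose N ** G"
  proof -
    \<comment> \<open>The product \<open>N^T (G H) N\<close> is evaluated in two ways: by
      \<open>H N = 1\<close>, and after \<open>GH\<close> by \<open>N^T H^T = 1\<close>.\<close>
    have "transpose N ** G = transpose N ** (G ** H) ** N"
      using HN(1) by (simp flip: matrix_mul_assoc)
    also have "\<dots> = (transpose N ** transpose H) ** G ** N"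
      unfolding GH by (simp add: matrix_mul_assoc)
    also have "\<dots> = G ** N" unfolding NH' by simp
    finally show ?thesis by simp
  qed
  have "G ** N ** T = transpose N ** (G ** T)"
    unfolding eq by (simp add: matrix_mul_assoc)
  also have "\<dots> = (transpose N ** transpose H) ** R"
    unfolding GT by (simp add: matrix_mul_assoc)
  also have "\<dots> = R" unfolding NH' by simp
  finally show "R ** E ** matrix_inv (T ** E) ** T = R"
    by (simp add: G_def N_def H_def)
  have "0 \<le> x \<bullet> ((G ** N) *v x)" for x
  proof -
    define y where "y = E *v (N *v x)"
    have "x = (H ** N) *v x" unfolding HN by simp
    then have "x = T *v y" unfolding H_def y_def by (simp add: matrix_vector_mul_assoc matrix_mul_assoc)
    moreover have "(G ** N) *v x = R *v y"
      by (simp add: G_def y_def matrix_vector_mul_assoc matrix_mul_assoc)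
    ultimately have "x \<bullet> ((G ** N) *v x) = y \<bullet> ((transpose R ** T) *v y)"
      using dot_lmul_matrix[of y "transpose R" "T *v y"]
      by (simp add: matrix_vector_mul_assoc vector_transpose_matrix inner_commute)
    then show ?thesis using assms(1) by (simp add: sym_pos_semidef_def)
  qed
  moreover have "transpose (G ** N) = G ** N"
    using symG eq by (simp add: matrix_transpose_mul G_def)
  ultimately have "sym_pos_semidef (G ** N)"
    by (simp add: sym_pos_semidef_def)
  moreover have "invertible (G ** N)"
    unfolding G_def N_def H_def by (rule invertible_mult[OF invG invertible_matrix_inv[OF invH]])
  ultimately show "sym_pos_def (R ** E ** matrix_inv (T ** E))"
    using sym_pos_def_of_semidef by (simp add: G_def N_def H_def)
qed

section \<open>Block matrices\<close>

lemma sum_UNIV_sum: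
  fixes f :: "'a::finite + 'b::finite \<Rightarrow> 'c::comm_monoid_add"
  shows "sum f UNIV = (\<Sum>a\<in>UNIV. f (Inl a)) + (\<Sum>b\<in>UNIV. f (Inr b))"
  by (simp add: sum.Plus flip: UNIV_Plus_UNIV)

lemma sum_UNIV_prod:
  fixes f :: "'a::finite \<times> 'b::finite \<Rightarrow> 'c::comm_monoid_add"
  shows "sum f UNIV = (\<Sum>a\<in>UNIV. \<Sum>b\<in>UNIV. f (a, b))"
  by (simp add: sum.cartesian_product)

lemma sum_range_inj:
  fixes f :: "'m::finite \<Rightarrow> 'c::comm_monoid_add"
  assumes "inj \<iota>" "\<And>i. i \<notin> range \<iota> \<Longrightarrow> f i = 0"
  shows "sum f UNIV = (\<Sum>b\<in>UNIV. f (\<iota> b))"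
proof -
  have "sum f UNIV = sum f (range \<iota>)"
    by (rule sum.mono_neutral_right) (use assms(2) in auto)
  then show ?thesis by (simp add: sum.reindex[OF assms(1)])
qed

lemma block_mat_nth [simp]:
  "block_mat A B C D $ Inl a $ Inl c = A $ a $ c"
  "block_mat A B C D $ Inl a $ Inr e = B $ a $ e"
  "block_mat A B C D $ Inr b $ Inl c = C $ b $ c"
  "block_mat A B C D $ Inr b $ Inr e = D $ b $ e"
  by (simp_all add: block_mat_def)

lemma join_nth [simp]: "join u w $ Inl a = u $ a" "join u w $ Inr b = w $ b"
  by (simp_all add: join_def)

text \<open>Extensionality split along the sum type, so that the entry rules for \<open>join\<close>
  and \<open>block_mat\<close> apply to each block.\<close>

lemma vec_eq_sum_iff: "(x :: 'c^('a::finite + 'b::finite)) = y \<longleftrightarrow> (\<forall>a. x $ Inl a = y $ Inl a) \<and> (\<forall>b. x $ Inr b = y $ Inr b)"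
  unfolding vec_eq_iff by (metis sum.exhaust)

lemma block_mat_mult:
  "block_mat A B C D ** block_mat A' B' C' D' =
     block_mat (A ** A' + B ** C') (A ** B' + B ** D') (C ** A' + D ** C') (C ** B' + D ** D')"
  by (simp add: vec_eq_sum_iff matrix_matrix_mult_def sum_UNIV_sum)

lemma transpose_block_mat:
  "transpose (block_mat A B C D) = block_mat (transpose A) (transpose C) (transpose B) (transpose D)"
  by (simp add: vec_eq_sum_iff transpose_def)

lemma block_mat_mult_vec: "block_mat A B C D *v join x y = join (A *v x + B *v y) (C *v x + D *v y)"
  by (simp add: vec_eq_sum_iff matrix_vector_mult_def sum_UNIV_sum)

lemma inner_join: "join x y \<bullet> join x' y' = x \<bullet> x' + y \<bullet> y'"
  by (simp add: inner_vec_def sum_UNIV_sum)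

lemma join_cases: obtains x y where "z = join x y"
proof
  show "z = join (\<chi> a. z $ Inl a) (\<chi> b. z $ Inr b)"
    by (simp add: vec_eq_sum_iff)
qed

lemma join_0: "join 0 0 = 0"
  by (simp add: vec_eq_sum_iff)

lemma u_part_join [simp]: "u_part (join u w) = u"
  by (simp add: u_part_def)

lemma sym_pos_def_block_diag:
  assumes "sym_pos_def A" "sym_pos_def D"
  shows "sym_pos_def (block_mat A 0 0 D)"
proof -
  have "0 < z \<bullet> (block_mat A 0 0 D *v z)" if nz: "z \<noteq> 0" for z
  proof -
    obtain x y where z: "z = join x y" by (rule join_cases)
    have "0 \<le> x \<bullet> (A *v x)" "0 \<le> y \<bullet> (D *v y)"
      using assms unfolding sym_pos_def_def by (metis inner_zero_left less_eq_real_def)+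
    moreover have "0 < x \<bullet> (A *v x) \<or> 0 < y \<bullet> (D *v y)"
      using assms nz join_0 unfolding sym_pos_def_def z by metis
    ultimately show ?thesis
      by (auto simp: z block_mat_mult_vec inner_join)
  qed
  then show ?thesis
    using assms by (simp add: sym_pos_def_def transpose_block_mat) (simp add: transpose_def zero_vec_def)
qed

lemma Ck_on_block_mat:
  fixes A :: "'a::real_normed_vector \<Rightarrow> real^'k^'k" and D :: "'a \<Rightarrow> real^'r^'r"
  assumes S: "open S" and "Ck_on k A S" "Ck_on k B S" "Ck_on k C S" "Ck_on k D S"
  shows "Ck_on k (\<lambda>x. block_mat (A x) (B x) (C x) (D x)) S"
proof (intro Ck_on_vec[OF S])
  show "Ck_on k (\<lambda>x. block_mat (A x) (B x) (C x) (D x) $ i $ j) S" for i j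
    by (cases i; cases j) (simp_all add: Ck_on_vec_nth assms)
qed

lemma Ck_on_scaleR:
  fixes f :: "'a::real_normed_vector \<Rightarrow> real" and A :: "'a \<Rightarrow> real^'n^'m"
  assumes S: "open S" and "Ck_on k f S" "Ck_on k A S"
  shows "Ck_on k (\<lambda>x. f x *\<^sub>R A x) S"
  by (intro Ck_on_vec[OF S]) (simp add: Ck_on_mult Ck_on_vec_nth assms)

section \<open>The symmetrizer\<close>

text \<open>For the family \<open>D\<close> this is the \<open>sd x md\<close> matrix of the blocks
  \<open>(D^21, D^22)\<close>, the zero rows being dropped. It serves as \<open>T\<close> in
  \<open>symmetrizer_block\<close>, and its value at \<open>diag_block a0\<close> as
  \<open>R\<close>.\<close>

definition rows_block ::
  "('s \<Rightarrow> 'm) \<Rightarrow> ('d \<Rightarrow> 'd \<Rightarrow> real^'m^'m) \<Rightarrow> real^('d::finite \<times> 'm::finite)^('d \<times> 's::finite)" where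
  "rows_block \<iota> M = (\<chi> p q. M (fst p) (fst q) $ \<iota> (snd p) $ snd q)"

text \<open>Right multiplication by this matrix keeps only the columns belonging to
  \<open>u_2\<close>. It is the \<open>E\<close> of \<open>symmetrizer_block\<close>, which makes
  \<open>H\<close> a product \<open>T E\<close>.\<close>

definition inclusion_mat :: "('s \<Rightarrow> 'm) \<Rightarrow> real^('d::finite \<times> 's::finite)^('d \<times> 'm::finite)" where
  "inclusion_mat \<iota> = (\<chi> q p. if q = (fst p, \<iota> (snd p)) then 1 else 0)"

text \<open>A family of blocks rather than one large matrix, so that \<open>diag(a0)\<close> passes
  through the same \<open>rows_block\<close> as \<open>D\<close>.\<close>

definition diag_block :: "real^'m^'m \<Rightarrow> 'd \<Rightarrow> 'd \<Rightarrow> real^'m^'m" where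
  "diag_block A j k = (if j = k then A else 0)"

text \<open>
  The \<open>w\<close>-block \<open>diag(a\<^sub>0\<^sup>2\<^sup>2) H\<^sup>-\<^sup>1\<close> of the symmetrizer: the matrix products in front of and
  under the inverse are \<open>diag(a\<^sub>0\<^sup>2\<^sup>2)\<close> and \<open>H\<close>, see \<open>rows_block_inclusion\<close>.
\<close>

definition w_symmetrizer ::
  "('s \<Rightarrow> 'm) \<Rightarrow> real^'m^'m \<Rightarrow> ('d \<Rightarrow> 'd \<Rightarrow> real^'m^'m) \<Rightarrow>
   real^('d::finite \<times> 's::finite)^('d \<times> 's)" where
  "w_symmetrizer \<iota> A D =
     rows_block \<iota> (diag_block A) ** inclusion_mat \<iota> ** matrix_inv (rows_block \<iota> D ** inclusion_mat \<iota>)"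

lemma rows_block_inclusion:
  "rows_block \<iota> M ** inclusion_mat \<iota> = big_block (\<lambda>j k. sub22 \<iota> (M j k))"
  by (simp add: vec_eq_iff matrix_matrix_mult_def rows_block_def inclusion_mat_def big_block_def
      sub22_def if_distrib cong: if_cong)

text \<open>Identifies \<open>R^T T\<close> with the matrix of (II). The diagonal structure leaves
  one block row, symmetry of \<open>A\<close> exchanges its indices, and the sum over
  \<open>range \<iota>\<close> extends to all indices since the other rows of \<open>D\<close>
  vanish.\<close>

lemma rows_block_diag_mult:
  fixes A :: "real^'m::finite^'m" and \<iota> :: "'s::finite \<Rightarrow> 'm"
    and D :: "'d::finite \<Rightarrow> 'd \<Rightarrow> real^'m^'m"
  assumes "inj \<iota>" "transpose A = A" "\<And>j k i l. i \<notin> range \<iota> \<Longrightarrow> D j k $ i $ l = 0"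
  shows "transpose (rows_block \<iota> (diag_block A)) ** rows_block \<iota> D = big_block (\<lambda>j k. A ** D j k)"
proof -
  have A: "A $ m $ i = A $ i $ m" for m i
    using assms(2) by (metis transpose_def vec_lambda_beta)
  have "(\<Sum>p\<in>UNIV. diag_block A (fst p) j $ \<iota> (snd p) $ i * D (fst p) k $ \<iota> (snd p) $ l) =
      (\<Sum>m\<in>UNIV. A $ i $ m * D j k $ m $ l)" for i l and j k :: 'd
  proof -
    have "(\<Sum>p\<in>UNIV. diag_block A (fst p) j $ \<iota> (snd p) $ i * D (fst p) k $ \<iota> (snd p) $ l) =
        (\<Sum>h\<in>UNIV. if h = j then \<Sum>b\<in>UNIV. A $ \<iota> b $ i * D h k $ \<iota> b $ l else 0)"
      unfolding sum_UNIV_prod by (intro sum.cong) (auto simp: diag_block_def)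
    also have "\<dots> = (\<Sum>b\<in>UNIV. A $ \<iota> b $ i * D j k $ \<iota> b $ l)"
      by simp
    also have "\<dots> = (\<Sum>b\<in>UNIV. A $ i $ \<iota> b * D j k $ \<iota> b $ l)"
      by (intro sum.cong refl) (metis A)
    also have "\<dots> = (\<Sum>m\<in>UNIV. A $ i $ m * D j k $ m $ l)"
      by (rule sum_range_inj[symmetric]) (use assms in auto)
    finally show ?thesis .
  qed
  then show ?thesis
    by (simp add: vec_eq_iff matrix_matrix_mult_def rows_block_def transpose_def big_block_def)
qed

lemma sym_diag_block:
  fixes A :: "real^'m::finite^'m"
  assumes "transpose A = A"
  shows "transpose (big_block (\<lambda>j k. sub22 \<iota> (diag_block A j k))) = big_block (\<lambda>j k. sub22 \<iota> (diag_block A j k))"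
proof -
  have "A $ m $ i = A $ i $ m" for m i
    using assms by (metis transpose_def vec_lambda_beta)
  then show ?thesis
    by (auto simp: vec_eq_iff transpose_def big_block_def sub22_def diag_block_def)
qed

text \<open>Each diagonal block is a principal submatrix of a positive definite matrix, so its
  kernel is trivial.\<close>

lemma invertible_diag_block:
  fixes A :: "real^'m::finite^'m" and \<iota> :: "'s::finite \<Rightarrow> 'm"
  assumes "inj \<iota>" "sym_pos_def A"
  shows "invertible (big_block (\<lambda>j k::'d::finite. sub22 \<iota> (diag_block A j k)))" (is "invertible ?G")
proof (rule invertible_if_kernel_zero)
  fix x assume x: "?G *v x = 0"
  have G: "(\<Sum>c\<in>UNIV. A $ \<iota> b $ \<iota> c * x $ (j, c)) = 0" for j b
  proof -
    have "0 = (?G *v x) $ (j, b)" using x by simp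
    also have "\<dots> = (\<Sum>h\<in>UNIV. if h = j then \<Sum>c\<in>UNIV. A $ \<iota> b $ \<iota> c * x $ (h, c) else 0)"
      unfolding matrix_vector_mult_def vec_lambda_beta sum_UNIV_prod
      by (intro sum.cong) (auto simp: big_block_def sub22_def diag_block_def)
    finally show ?thesis by simp
  qed
  have "x $ (j, b) = 0" for j b
  proof -
    \<comment> \<open>Extension by zero of the \<open>j\<close>-th block of \<open>x\<close>. On
      \<open>range \<iota>\<close> the vector \<open>A *v y\<close> vanishes by \<open>G\<close>,
      and elsewhere \<open>y\<close> does, so \<open>y \<bullet> (A *v y) = 0\<close>.\<close>
    define y :: "real^'m" where "y = (\<chi> i. if i \<in> range \<iota> then x $ (j, inv \<iota> i) else 0)"
    have y: "y $ \<iota> c = x $ (j, c)" "i \<notin> range \<iota> \<Longrightarrow> y $ i = 0" for c i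
      using assms(1) by (simp_all add: y_def)
    have "(A *v y) $ \<iota> c = 0" for c
      unfolding matrix_vector_mult_def vec_lambda_beta
      by (subst sum_range_inj[OF assms(1)]) (simp_all add: y G)
    then have "y \<bullet> (A *v y) = 0"
      unfolding inner_vec_def by (subst sum_range_inj[OF assms(1)]) (simp_all add: y)
    then have "y = 0"
      using assms(2) unfolding sym_pos_def_def by (metis less_irrefl)
    then show ?thesis using y(1)[of b] by simp
  qed
  then show "x = 0" by (simp add: vec_eq_iff)
qed

text \<open>An instance of \<open>symmetrizer_block\<close>: \<open>R^T T\<close> is the matrix of
  (II), \<open>R E\<close> is \<open>diag(a0^22)\<close> and \<open>T E\<close> is
  \<open>H\<close>.\<close>

lemma w_symmetrizer:
  fixes A :: "real^'m::finite^'m" and \<iota> :: "'s::finite \<Rightarrow> 'm"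
    and D :: "'d::finite \<Rightarrow> 'd \<Rightarrow> real^'m^'m"
  assumes "inj \<iota>" "sym_pos_def A" "\<And>j k i l. i \<notin> range \<iota> \<Longrightarrow> D j k $ i $ l = 0"
    and "sym_pos_semidef (big_block (\<lambda>j k. A ** D j k))"
    and "invertible (big_block (\<lambda>j k. sub22 \<iota> (D j k)))"
  shows "sym_pos_def (w_symmetrizer \<iota> A D)"
    and "w_symmetrizer \<iota> A D ** rows_block \<iota> D = rows_block \<iota> (diag_block A)"
proof -
  have A: "transpose A = A" using assms(2) by (simp add: sym_pos_def_def)
  note * = rows_block_diag_mult[OF assms(1) A assms(3)] rows_block_inclusion
    sym_diag_block[OF A] invertible_diag_block[OF assms(1,2)] assms(4,5)
  show "sym_pos_def (w_symmetrizer \<iota> A D)"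
    unfolding w_symmetrizer_def by (rule symmetrizer_block(1)) (simp_all add: *)
  show "w_symmetrizer \<iota> A D ** rows_block \<iota> D = rows_block \<iota> (diag_block A)"
    unfolding w_symmetrizer_def by (rule symmetrizer_block(2)) (simp_all add: *)
qed

text \<open>There is no argument \<epsilon>: the factor \<epsilon> in front of \<open>a j\<close>
  does not affect the symmetry conditions, so one symmetrizer serves all \<epsilon>.\<close>

definition relax_A0 ::
  "('s::finite \<Rightarrow> 'm::finite) \<Rightarrow> (real^'m \<Rightarrow> real^'m^'m) \<Rightarrow>
   ('d::finite \<Rightarrow> 'd \<Rightarrow> real^'m \<Rightarrow> real^'m^'m) \<Rightarrow>
   real^('m + 'd \<times> 's) \<Rightarrow> real^('m + 'd \<times> 's)^('m + 'd \<times> 's)" where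
  "relax_A0 \<iota> a0 D U =
     block_mat (a0 (u_part U)) 0 0 (w_symmetrizer \<iota> (a0 (u_part U)) (\<lambda>j k. D j k (u_part U)))"

lemma transpose_0 [simp]: "transpose 0 = 0"
  by (simp add: vec_eq_iff transpose_def)

lemma matrix_mult_0 [simp]: "(0 :: real^'n^'m) ** (B :: real^'p^'n) = 0" "(A :: real^'n^'m) ** (0 :: real^'p^'n) = 0"
  by (simp_all add: vec_eq_iff matrix_matrix_mult_def)

lemma matrix_mult_scaleR:
  fixes A :: "real^'n^'m" and B :: "real^'p^'n"
  shows "A ** (c *\<^sub>R B) = c *\<^sub>R (A ** B)" "(c *\<^sub>R A) ** B = c *\<^sub>R (A ** B)"
  by (simp_all add: vec_eq_iff matrix_matrix_mult_def sum_distrib_left mult.assoc mult.left_commute)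

text \<open>Compared blockwise, the \<open>u\<close>-\<open>u\<close> block is (I) scaled by
  \<epsilon>, the \<open>w\<close>-\<open>w\<close> blocks are zero, and the two mixed identities
  are transposes of each other. The one to prove is
  \<open>M ** F = transpose E ** a0 u\<close>.\<close>

lemma relax_A0_symmetrizes:
  fixes \<iota> :: "'s::finite \<Rightarrow> 'm::finite" and D :: "'d::finite \<Rightarrow> 'd \<Rightarrow> real^'m \<Rightarrow> real^'m^'m"
  assumes u: "u = u_part U" and sym: "transpose (a0 u) = a0 u" "transpose (a0 u ** a j u) = a0 u ** a j u"
    and W: "transpose (w_symmetrizer \<iota> (a0 u) (\<lambda>j k. D j k u)) = w_symmetrizer \<iota> (a0 u) (\<lambda>j k. D j k u)"
    "w_symmetrizer \<iota> (a0 u) (\<lambda>j k. D j k u) ** rows_block \<iota> (\<lambda>j k. D j k u) = rows_block \<iota> (diag_block (a0 u))"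
  shows "relax_A0 \<iota> a0 D U ** relax_A \<iota> a D j U \<epsilon> = transpose (relax_A \<iota> a D j U \<epsilon>) ** relax_A0 \<iota> a0 D U"
proof -
  define M where "M = w_symmetrizer \<iota> (a0 u) (\<lambda>j k. D j k u)"
  define E :: "real^('d \<times> 's)^'m" where "E = (\<chi> i p. if fst p = j \<and> i = \<iota> (snd p) then 1 else 0)"
  define F :: "real^'m^('d \<times> 's)" where "F = (\<chi> p l. D (fst p) j u $ \<iota> (snd p) $ l)"
  have "M ** F = transpose E ** a0 u"
  proof -
    have "(M ** F) $ p $ l = (transpose E ** a0 u) $ p $ l" for p l
    proof -
      \<comment> \<open>\<open>F\<close> consists of the columns of \<open>rows_block\<close> with
        first index \<open>j\<close>, so the identity is the \<open>j\<close>-th block column of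
        \<open>W(2)\<close>.\<close>
      have "(M ** F) $ p $ l = (M ** rows_block \<iota> (\<lambda>j k. D j k u)) $ p $ (j, l)"
        by (simp add: matrix_matrix_mult_def F_def rows_block_def)
      also have "\<dots> = (if fst p = j then a0 u $ \<iota> (snd p) $ l else 0)"
        unfolding M_def W(2) by (simp add: rows_block_def diag_block_def)
      also have "\<dots> = (transpose E ** a0 u) $ p $ l"
        by (auto simp: matrix_matrix_mult_def transpose_def E_def if_distrib[of "\<lambda>x. x * _"] cong: if_cong)
      finally show ?thesis .
    qed
    then show ?thesis by (simp add: vec_eq_iff)
  qed
  moreover from this have "a0 u ** E = transpose F ** M"
    using sym(1) W(1) unfolding M_def by (metis matrix_transpose_mul transpose_transpose)
  moreover have "a0 u ** (\<epsilon> *\<^sub>R a j u) = transpose (\<epsilon> *\<^sub>R a j u) ** a0 u"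
    using sym by (simp add: matrix_transpose_mul transpose_scalar matrix_mult_scaleR)
  ultimately show ?thesis
    unfolding relax_A_def relax_A0_def u[symmetric] M_def[symmetric] E_def[symmetric] F_def[symmetric]
    by (simp add: block_mat_mult transpose_block_mat)
qed

section \<open>The linear source term and its Jacobian\<close>

lemma bounded_linear_u_part: "bounded_linear u_part"
  by (simp add: linear_conv_bounded_linear[symmetric] linear_iff vec_eq_iff u_part_def)

lemma bounded_linear_w_part: "bounded_linear (\<lambda>U :: real^('a::finite + 'b::finite). \<chi> p. U $ Inr p)"
  by (simp add: linear_conv_bounded_linear[symmetric] linear_iff vec_eq_iff)

lemma minus_mat_1_mult_vec: "(- mat 1) *v w = - (w :: real^'n)"
  by (simp add: vec_eq_iff matrix_vector_mult_def mat_def if_distrib[of "\<lambda>x. x * _"] sum_negf cong: if_cong)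

text \<open>As a matrix product, the source has its smoothness and its Jacobian by
  linearity.\<close>

lemma relax_Q_eq: "relax_Q U \<epsilon> = block_mat 0 0 0 (- mat 1) *v U"
proof -
  obtain x y where U: "U = join x y" by (rule join_cases)
  show ?thesis
    by (simp add: U block_mat_mult_vec relax_Q_def minus_mat_1_mult_vec vec_lambda_eta)
qed

lemma jacobian_matrix_mult: "jacobian (\<lambda>x. A *v x) (at z) = (A :: real^'n^'m)"
proof -
  have "((\<lambda>x. A *v x) has_derivative (\<lambda>x. A *v x)) (at z)"
    by (rule bounded_linear_imp_has_derivative) (rule matrix_vector_mul_bounded_linear)
  then show ?thesis
    by (simp add: jacobian_def flip: frechet_derivative_at)
qed

section \<open>Equivalence of the two forms of the system\<close>

text \<open>Differentiability matters here: otherwise \<open>vector_derivative\<close> is an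
  arbitrary choice, and choices for a vector and for its components need not agree.\<close>

lemma vector_derivative_nth:
  fixes f :: "real \<Rightarrow> real^'n"
  assumes "f differentiable (at t)"
  shows "vector_derivative f (at t) $ i = vector_derivative (\<lambda>\<tau>. f \<tau> $ i) (at t)"
proof -
  have "(f has_vector_derivative vector_derivative f (at t)) (at t)"
    using assms by (rule vector_derivative_works[THEN iffD1])
  then have "((\<lambda>\<tau>. f \<tau> $ i) has_vector_derivative vector_derivative f (at t) $ i) (at t)"
    by (rule bounded_linear.has_vector_derivative[OF bounded_linear_vec_nth])
  then show ?thesis
    by (rule vector_derivative_at[symmetric])
qed

text \<open>Joint differentiability at \<open>(t, x)\<close> restricts to the line in direction
  \<open>t\<close>, where components may be taken inside the derivative.\<close>

lemma dt_nth:
  assumes "(\<lambda>(\<tau>, y). f \<tau> y) differentiable (at (t, x))"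
  shows "dt f t x $ i = vector_derivative (\<lambda>\<tau>. f \<tau> x $ i) (at t)"
proof -
  have "((\<lambda>\<tau>. (\<tau>, x)) has_derivative (\<lambda>v. (v, 0))) (at t)"
    by (auto intro!: derivative_eq_intros)
  then have "(\<lambda>\<tau>. (\<tau>, x)) differentiable (at t)"
    by (rule differentiableI)
  then have "(\<lambda>\<tau>. (\<lambda>(\<tau>, y). f \<tau> y) (\<tau>, x)) differentiable (at t)"
    by (rule differentiable_compose[where g = "\<lambda>\<tau>. (\<tau>, x)", OF assms])
  then have "(\<lambda>\<tau>. f \<tau> x) differentiable (at t)"
    by simp
  then show ?thesis
    unfolding dt_def by (rule vector_derivative_nth)
qed

lemma dx_nth:
  assumes "(\<lambda>(\<tau>, y). f \<tau> y) differentiable (at (t, x))"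
  shows "dx j f t x $ i = vector_derivative (\<lambda>h. f t (x + h *\<^sub>R axis j 1) $ i) (at 0)"
proof -
  have "((\<lambda>h::real. (t, x + h *\<^sub>R axis j 1)) has_derivative (\<lambda>v. (0, v *\<^sub>R axis j 1))) (at 0)"
    by (auto intro!: derivative_eq_intros)
  then have "(\<lambda>h::real. (t, x + h *\<^sub>R axis j 1)) differentiable (at 0)"
    by (rule differentiableI)
  moreover have "(\<lambda>(\<tau>, y). f \<tau> y) differentiable (at (t, x + 0 *\<^sub>R axis j 1))"
    using assms by simp
  ultimately have "(\<lambda>h::real. (\<lambda>(\<tau>, y). f \<tau> y) (t, x + h *\<^sub>R axis j 1)) differentiable (at 0)"
    by (intro differentiable_compose[where g = "\<lambda>h::real. (t, x + h *\<^sub>R axis j 1)" and f = "\<lambda>(\<tau>, y). f \<tau> y"])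
  then have "(\<lambda>h. f t (x + h *\<^sub>R axis j 1)) differentiable (at 0)"
    by simp
  then show ?thesis
    unfolding dx_def by (rule vector_derivative_nth)
qed

lemma differentiable_vec_nth_iff:
  fixes f :: "'a::real_normed_vector \<Rightarrow> real^'n"
  shows "f differentiable F \<longleftrightarrow> (\<forall>i. (\<lambda>x. f x $ i) differentiable F)"
proof
  assume "f differentiable F"
  then obtain f' where "(f has_derivative f') F"
    unfolding differentiable_def by blast
  then have "((\<lambda>x. f x $ i) has_derivative (\<lambda>v. f' v $ i)) F" for i
    by (rule bounded_linear.has_derivative[OF bounded_linear_vec_nth])
  then show "\<forall>i. (\<lambda>x. f x $ i) differentiable F"
    by (intro allI differentiableI)
next
  assume f: "\<forall>i. (\<lambda>x. f x $ i) differentiable F"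
  define f' where "f' i = frechet_derivative (\<lambda>x. f x $ i) F" for i
  have f': "((\<lambda>x. f x $ i) has_derivative f' i) F" for i
    using f unfolding f'_def by (simp add: frechet_derivative_works)
  have "((\<lambda>x. \<Sum>i\<in>UNIV. axis i (f x $ i)) has_derivative (\<lambda>v. \<Sum>i\<in>UNIV. axis i (f' i v))) F"
    by (intro has_derivative_sum bounded_linear.has_derivative[where f = "axis _"] bounded_linear_axis f')
  then have "(f has_derivative (\<lambda>v. \<Sum>i\<in>UNIV. axis i (f' i v))) F"
    by (simp add: sum_axis_nth)
  then show "f differentiable F"
    by (rule differentiableI)
qed

lemma stack_nth [simp]: "stack w $ p = w (fst p) $ snd p"
  by (simp add: stack_def)

text \<open>Joint differentiability of \<open>u\<close> and \<open>w\<close> carries over to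
  \<open>U\<close>, so the derivatives of \<open>U\<close> split into those of \<open>u\<close> and
  \<open>w\<close>. Both forms are then compared row by row.\<close>

lemma relaxation_iff_system:
  fixes \<iota> :: "'s::finite \<Rightarrow> 'm::finite" and w :: "'d::finite \<Rightarrow> real \<Rightarrow> real^'d \<Rightarrow> real^'s"
  assumes "inj \<iota>" "0 < \<epsilon>"
    and u: "(\<lambda>(\<tau>, y). u \<tau> y) differentiable (at (t, x))"
    and w: "\<And>j. (\<lambda>(\<tau>, y). w j \<tau> y) differentiable (at (t, x))"
  shows "solves_relaxation_at \<iota> a D \<epsilon> u w t x \<longleftrightarrow>
    solves_system_at (relax_A \<iota> a D) relax_Q \<epsilon> (\<lambda>\<tau> y. join (u \<tau> y) (stack (\<lambda>j. w j \<tau> y))) t x"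
proof -
  define U where "U = (\<lambda>\<tau> y. join (u \<tau> y) (stack (\<lambda>j. w j \<tau> y)))"
  have U_nth: "U \<tau> y $ Inl i = u \<tau> y $ i" "U \<tau> y $ Inr p = w (fst p) \<tau> y $ snd p" for \<tau> y i p
    by (simp_all add: U_def)
  have U: "(\<lambda>(\<tau>, y). U \<tau> y) differentiable (at (t, x))"
  proof -
    have "(\<lambda>z. (case z of (\<tau>, y) \<Rightarrow> U \<tau> y) $ i) differentiable (at (t, x))" for i
    proof (cases i)
      case (Inl a)
      have "(\<lambda>z. (case z of (\<tau>, y) \<Rightarrow> u \<tau> y) $ a) differentiable (at (t, x))"
        by (rule differentiable_vec_nth_iff[THEN iffD1, OF u, THEN spec])
      then show ?thesis
        unfolding Inl split_def U_nth .
    next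
      case (Inr p)
      have "(\<lambda>z. (case z of (\<tau>, y) \<Rightarrow> w (fst p) \<tau> y) $ snd p) differentiable (at (t, x))"
        by (rule differentiable_vec_nth_iff[THEN iffD1, OF w, THEN spec])
      then show ?thesis
        unfolding Inr split_def U_nth .
    qed
    then show ?thesis
      by (intro differentiable_vec_nth_iff[THEN iffD2] allI)
  qed
  have deriv: "dt U t x $ Inl i = dt u t x $ i" "dt U t x $ Inr p = dt (w (fst p)) t x $ snd p"
    "dx j U t x $ Inl i = dx j u t x $ i" "dx j U t x $ Inr p = dx j (w (fst p)) t x $ snd p" for i p j
    by (simp_all add: dt_nth[OF U] dx_nth[OF U] dt_nth[OF u] dx_nth[OF u] dt_nth[OF w] dx_nth[OF w] U_nth)
  have u_part: "u_part (U t x) = u t x" by (simp add: U_def)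
  \<comment> \<open>\<open>W j i\<close> is the contribution of \<open>w\<close> to row
    \<open>i\<close> of \<open>A_j\<close> times the \<open>j\<close>-th derivative of
    \<open>U\<close>. By injectivity of \<iota> it is a single component of the derivative of
    \<open>w j\<close> on \<open>range \<iota>\<close>, and it is zero elsewhere.\<close>
  define W where "W j i = (\<Sum>p\<in>UNIV. (if fst p = j \<and> i = \<iota> (snd p) then 1 else 0) * dx j (w (fst p)) t x $ snd p)" for j i
  have W: "W j i = (\<Sum>b\<in>UNIV. if i = \<iota> b then dx j (w j) t x $ b else 0)" for j i
  proof -
    have "W j i = (\<Sum>h\<in>UNIV. if h = j then \<Sum>b\<in>UNIV. if i = \<iota> b then dx j (w j) t x $ b else 0 else 0)"
      unfolding W_def sum_UNIV_prod by (intro sum.cong) (auto intro!: sum.cong)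
    then show ?thesis by simp
  qed
  have W1: "W j i = 0" if "i \<notin> range \<iota>" for j i
    unfolding W using that by (intro sum.neutral) auto
  have W2: "W j (\<iota> b) = dx j (w j) t x $ b" for j b
    unfolding W using assms(1) by (simp add: inj_eq)
  have A1: "(relax_A \<iota> a D j (U t x) \<epsilon> *v dx j U t x) $ Inl i =
      \<epsilon> * (\<Sum>l\<in>UNIV. a j (u t x) $ i $ l * dx j u t x $ l) + W j i" for i j
    by (simp add: relax_A_def matrix_vector_mult_def sum_UNIV_sum deriv u_part W_def sum_distrib_left mult.assoc)
  have A2: "(relax_A \<iota> a D j (U t x) \<epsilon> *v dx j U t x) $ Inr p =
      (\<Sum>l\<in>UNIV. D (fst p) j (u t x) $ \<iota> (snd p) $ l * dx j u t x $ l)" for p j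
    by (simp add: relax_A_def matrix_vector_mult_def sum_UNIV_sum deriv u_part)
  have Q: "relax_Q (U t x) \<epsilon> $ Inl i = 0" "relax_Q (U t x) \<epsilon> $ Inr p = - w (fst p) t x $ snd p" for i p
    by (simp_all add: relax_Q_def U_nth)
  have "solves_system_at (relax_A \<iota> a D) relax_Q \<epsilon> U t x \<longleftrightarrow>
      (\<forall>i. dt u t x $ i + (\<Sum>j\<in>UNIV. \<Sum>l\<in>UNIV. a j (u t x) $ i $ l * dx j u t x $ l)
        + (1 / \<epsilon>) * (\<Sum>j\<in>UNIV. W j i) = 0) \<and>
      (\<forall>p. dt (w (fst p)) t x $ snd p
        + (1 / \<epsilon>) * (\<Sum>k\<in>UNIV. \<Sum>l\<in>UNIV. D (fst p) k (u t x) $ \<iota> (snd p) $ l * dx k u t x $ l)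
        = - (1 / \<epsilon>\<^sup>2) * w (fst p) t x $ snd p)"
  proof -
    \<comment> \<open>The prefactor cancels the \<epsilon> in front of \<open>a j\<close> but
      remains in front of the derivatives of \<open>w\<close>.\<close>
    have "(1 / \<epsilon>) * (\<Sum>j\<in>UNIV. \<epsilon> * X j + W j i) = (\<Sum>j\<in>UNIV. X j) + (1 / \<epsilon>) * (\<Sum>j\<in>UNIV. W j i)" for X i
      using assms(2) by (simp add: sum.distrib distrib_left flip: sum_distrib_left)
    then show ?thesis
      unfolding solves_system_at_def vec_eq_sum_iff vector_add_component vector_scaleR_component
        sum_component deriv A1 A2 Q by (simp only: add.assoc) simp
  qed
  also have "\<dots> \<longleftrightarrow> solves_relaxation_at \<iota> a D \<epsilon> u w t x"
  proof -
    \<comment> \<open>Splits the rows for \<open>u\<close> into the equations for \<open>u_1\<close>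
      (outside \<open>range \<iota>\<close>) and \<open>u_2\<close>.\<close>
    have "(\<forall>i. P i) \<longleftrightarrow> (\<forall>i. i \<notin> range \<iota> \<longrightarrow> P i) \<and> (\<forall>b. P (\<iota> b))" for P :: "'m \<Rightarrow> bool"
      by (metis rangeE)
    note split = this[of "\<lambda>i. dt u t x $ i + (\<Sum>j\<in>UNIV. \<Sum>l\<in>UNIV. a j (u t x) $ i $ l * dx j u t x $ l)
        + (1 / \<epsilon>) * (\<Sum>j\<in>UNIV. W j i) = 0"]
    show ?thesis
      unfolding split solves_relaxation_at_def by (simp add: W1 W2 split_paired_All)
  qed
  finally show ?thesis unfolding U_def by simp
qed

section \<open>Smoothness of the coefficients and convergence criteria\<close>

text \<open>The formulas make sense for every real \<epsilon>, so the open set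
  \<open>\<Omega> \<times> UNIV\<close> provides the neighbourhood needed for smoothness up to
  \<epsilon> = 0.\<close>

lemma smooth_on_case_prodI:
  assumes "open \<Omega>" "\<And>k. Ck_on k (\<lambda>z. f (fst z) (snd z)) (\<Omega> \<times> UNIV)"
  shows "smooth_on (\<Omega> \<times> {0..1}) (\<lambda>(U, \<epsilon>). f U (\<epsilon>::real))"
proof (rule smooth_on_mono)
  show "smooth_on (\<Omega> \<times> UNIV) (\<lambda>(U, \<epsilon>). f U \<epsilon>)"
    using assms by (simp add: smooth_on_open open_Times case_prod_unfold)
qed auto

lemma Ck_on_u_part:
  fixes \<Omega> :: "(real^('m::finite + 'r::finite)) set"
  assumes "state_spaces \<Omega>u \<Omega>" "Ck_on k f \<Omega>u"
  shows "Ck_on k (\<lambda>z. f (u_part (fst z))) (\<Omega> \<times> (UNIV :: real set))"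
proof (rule Ck_on_compose_linear[OF _ _ assms(2)])
  show "open (\<Omega> \<times> (UNIV :: real set))"
    using assms(1) by (simp add: state_spaces_def open_Times)
  show "bounded_linear (\<lambda>z :: (real^('m + 'r)) \<times> real. u_part (fst z))"
    by (intro bounded_linear_compose[OF bounded_linear_u_part] bounded_linear_fst)
  show "(\<lambda>z. u_part (fst z)) ` (\<Omega> \<times> (UNIV :: real set)) \<subseteq> \<Omega>u"
    using assms(1) by (auto simp: state_spaces_def) (metis join_cases u_part_join)
qed

lemma Ck_on_rows_block:
  fixes M :: "'a::real_normed_vector \<Rightarrow> 'd::finite \<Rightarrow> 'd \<Rightarrow> real^'m::finite^'m" and \<iota> :: "'s::finite \<Rightarrow> 'm"
  assumes S: "open S" and "\<And>j k. Ck_on n (\<lambda>x. M x j k) S"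
  shows "Ck_on n (\<lambda>x. rows_block \<iota> (M x)) S"
  by (intro Ck_on_vec[OF S]) (simp add: rows_block_def Ck_on_vec_nth assms)

text \<open>The matrix inverted in \<open>w_symmetrizer\<close> is \<open>H\<close>, so its
  invertibility on \<open>S\<close> makes the inverse smooth.\<close>

lemma Ck_on_w_symmetrizer:
  fixes A :: "'a::real_normed_vector \<Rightarrow> real^'m::finite^'m" and \<iota> :: "'s::finite \<Rightarrow> 'm"
    and D :: "'a \<Rightarrow> 'd::finite \<Rightarrow> 'd \<Rightarrow> real^'m^'m"
  assumes S: "open S" and A: "Ck_on n A S" and D: "\<And>j k. Ck_on n (\<lambda>x. D x j k) S"
    and "\<And>x. x \<in> S \<Longrightarrow> invertible (big_block (\<lambda>j k. sub22 \<iota> (D x j k)))"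
  shows "Ck_on n (\<lambda>x. w_symmetrizer \<iota> (A x) (D x)) S"
proof -
  have "Ck_on n (\<lambda>x. diag_block (A x) j k) S" for j k :: 'd
    by (cases "j = k") (simp_all add: diag_block_def A Ck_on_const S)
  then show ?thesis
    unfolding w_symmetrizer_def
    by (intro Ck_on_matrix_mult Ck_on_matrix_inv Ck_on_rows_block Ck_on_const S D)
       (simp_all add: rows_block_inclusion assms(4))
qed

lemma relax_smooth_coefficients:
  fixes \<Omega> :: "(real^('m::finite + 'd::finite \<times> 's::finite)) set" and \<iota> :: "'s \<Rightarrow> 'm"
  assumes st: "state_spaces \<Omega>u \<Omega>" and a: "\<And>j. smooth_on \<Omega>u (a j)" and D: "\<And>j k. smooth_on \<Omega>u (D j k)"
  shows "smooth_coefficients \<Omega> (relax_A \<iota> a D) relax_Q"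
proof -
  have o: "open \<Omega>" "open \<Omega>u" using st by (auto simp: state_spaces_def)
  then have S: "open (\<Omega> \<times> (UNIV :: real set))" by (simp add: open_Times)
  have aD: "Ck_on k (\<lambda>z. a j (u_part (fst z))) (\<Omega> \<times> (UNIV :: real set))"
    "Ck_on k (\<lambda>z. D i j (u_part (fst z))) (\<Omega> \<times> (UNIV :: real set))" for k i j
    using a D Ck_on_u_part[OF st, of k "a j"] Ck_on_u_part[OF st, of k "D i j"]
    by (simp_all add: smooth_on_open[OF o(2)])
  have F: "Ck_on k (\<lambda>z. (\<chi> p l. D (fst p) j (u_part (fst z)) $ \<iota> (snd p) $ l) :: real^'m^('d \<times> 's))
      (\<Omega> \<times> (UNIV :: real set))" for k j
    by (intro Ck_on_vec[OF S]) (simp add: Ck_on_vec_nth[OF S] aD)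
  have "Ck_on k (\<lambda>z. relax_A \<iota> a D j (fst z) (snd z)) (\<Omega> \<times> UNIV)" for k j
    unfolding relax_A_def
    by (intro Ck_on_block_mat Ck_on_scaleR Ck_on_const aD F S Ck_on_bounded_linear bounded_linear_snd)
  moreover have "Ck_on k (\<lambda>z. relax_Q (fst z) (snd z)) (\<Omega> \<times> UNIV)" for k
    unfolding relax_Q_eq
    by (intro Ck_on_bounded_linear S bounded_linear_compose[OF matrix_vector_mul_bounded_linear] bounded_linear_fst)
  ultimately show ?thesis
    unfolding smooth_coefficients_def by (blast intro: smooth_on_case_prodI o)
qed

section \<open>Verification of the convergence criteria\<close>

theorem theorem4p2:
  fixes \<Omega>u :: "(real^'m::finite) set"
    and \<Omega> :: "(real^('m + 'd::finite \<times> 's::finite)) set"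
    and \<iota> :: "'s \<Rightarrow> 'm"
    and a :: "'d \<Rightarrow> real^'m \<Rightarrow> real^'m^'m"
    and D :: "'d \<Rightarrow> 'd \<Rightarrow> real^'m \<Rightarrow> real^'m^'m"
    and a0 :: "real^'m \<Rightarrow> real^'m^'m"
  assumes "inj \<iota>"
    and "state_spaces \<Omega>u \<Omega>"
    and "\<And>j. smooth_on \<Omega>u (a j)"
    and "\<And>j k. smooth_on \<Omega>u (D j k)"
    and "\<And>j k u i l. u \<in> \<Omega>u \<Longrightarrow> i \<notin> range \<iota> \<Longrightarrow> D j k u $ i $ l = 0"
    and "smooth_on \<Omega>u a0"
    and "\<And>u. u \<in> \<Omega>u \<Longrightarrow> sym_pos_def (a0 u)"
    and "\<And>u j. u \<in> \<Omega>u \<Longrightarrow> transpose (a0 u ** a j u) = a0 u ** a j u"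
    and "\<And>u. u \<in> \<Omega>u \<Longrightarrow> sym_pos_semidef (big_block (\<lambda>j k. a0 u ** D j k u))"
    and "\<And>u. u \<in> \<Omega>u \<Longrightarrow> invertible (big_block (\<lambda>j k. sub22 \<iota> (D j k u)))"
  shows "(\<forall>u w t x \<epsilon>. 0 < \<epsilon> \<and> \<epsilon> \<le> 1 \<and>
            (\<lambda>(\<tau>, y). u \<tau> y) differentiable (at (t, x)) \<and>
            (\<forall>j. (\<lambda>(\<tau>, y). w j \<tau> y) differentiable (at (t, x))) \<and>
            join (u t x) (stack (\<lambda>j. w j t x)) \<in> \<Omega> \<longrightarrow>
            (solves_relaxation_at \<iota> a D \<epsilon> u w t x \<longleftrightarrow>
             solves_system_at (relax_A \<iota> a D) relax_Q \<epsilon>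
               (\<lambda>\<tau> y. join (u \<tau> y) (stack (\<lambda>j. w j \<tau> y))) t x))
         \<and> smooth_coefficients \<Omega> (relax_A \<iota> a D) relax_Q
         \<and> convergence_criteria \<Omega>u \<Omega> (relax_A \<iota> a D) relax_Q"
proof (intro conjI)
  show "\<forall>u w t x \<epsilon>. 0 < \<epsilon> \<and> \<epsilon> \<le> 1 \<and>
            (\<lambda>(\<tau>, y). u \<tau> y) differentiable (at (t, x)) \<and>
            (\<forall>j. (\<lambda>(\<tau>, y). w j \<tau> y) differentiable (at (t, x))) \<and>
            join (u t x) (stack (\<lambda>j. w j t x)) \<in> \<Omega> \<longrightarrow>
            (solves_relaxation_at \<iota> a D \<epsilon> u w t x \<longleftrightarrow>
             solves_system_at (relax_A \<iota> a D) relax_Q \<epsilon>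
               (\<lambda>\<tau> y. join (u \<tau> y) (stack (\<lambda>j. w j \<tau> y))) t x)"
    using relaxation_iff_system[OF assms(1)] by blast
  show "smooth_coefficients \<Omega> (relax_A \<iota> a D) relax_Q"
    by (rule relax_smooth_coefficients[OF assms(2-4)])
  have o: "open \<Omega>" "open \<Omega>u" using assms(2) by (auto simp: state_spaces_def)
  then have S: "open (\<Omega> \<times> (UNIV :: real set))" by (simp add: open_Times)
  have inO: "u_part U \<in> \<Omega>u" if "U \<in> \<Omega>" for U
    using that assms(2) unfolding state_spaces_def by (metis join_cases u_part_join)
  define M where "M u = w_symmetrizer \<iota> (a0 u) (\<lambda>j k. D j k u)" for u
  have M: "sym_pos_def (M u)" "M u ** rows_block \<iota> (\<lambda>j k. D j k u) = rows_block \<iota> (diag_block (a0 u))"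
    if "u \<in> \<Omega>u" for u
    unfolding M_def using w_symmetrizer[OF assms(1) assms(7) assms(5) assms(9) assms(10)] that by blast+
  have sym: "transpose (M u) = M u" "transpose (a0 u) = a0 u" if "u \<in> \<Omega>u" for u
    using M(1) assms(7) that by (auto simp: sym_pos_def_def)
  define q where "q = (\<lambda>(U :: real^('m + 'd \<times> 's)) (\<epsilon> :: real). - (\<chi> p. U $ Inr p))"
  \<comment> \<open>In this form the Jacobian of \<open>q\<close> in \<open>w\<close> is visibly
    \<open>- mat 1\<close>.\<close>
  have q: "q (join u w) \<epsilon> = (- mat 1) *v w" for u w \<epsilon>
    by (simp add: q_def minus_mat_1_mult_vec vec_eq_iff)
  show "convergence_criteria \<Omega>u \<Omega> (relax_A \<iota> a D) relax_Q"
    unfolding convergence_criteria_def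
  proof (rule exI[of _ q], rule exI[of _ "\<lambda>U _. relax_A0 \<iota> a0 D U"], rule exI[of _ "\<lambda>u. 2 *\<^sub>R M u"],
      intro conjI ballI allI impI)
    have "Ck_on k (\<lambda>z. q (fst z) (snd z)) (\<Omega> \<times> UNIV)" for k
      unfolding q_def
      by (intro Ck_on_bounded_linear S bounded_linear_minus bounded_linear_compose[OF bounded_linear_w_part] bounded_linear_fst)
    then show "smooth_on (\<Omega> \<times> {0..1}) (\<lambda>(U, \<epsilon>). q U \<epsilon>)"
      by (intro smooth_on_case_prodI o)
    show "relax_Q U \<epsilon> = join 0 (q U \<epsilon>)" for U \<epsilon>
      by (simp add: relax_Q_def q_def)
    show "q (join u w) 0 = 0 \<longleftrightarrow> w = 0" for u w
      by (simp add: q_def vec_eq_iff)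
    show "invertible (jacobian (\<lambda>w. q (join u w) 0) (at 0))" for u
      unfolding q jacobian_matrix_mult
      by (rule invertible_if_kernel_zero) (simp add: minus_mat_1_mult_vec)
    have "Ck_on k (\<lambda>z. a0 (u_part (fst z))) (\<Omega> \<times> (UNIV :: real set))"
      "Ck_on k (\<lambda>z. D i j (u_part (fst z))) (\<Omega> \<times> (UNIV :: real set))" for k i j
      using assms(4,6) Ck_on_u_part[OF assms(2), of k a0] Ck_on_u_part[OF assms(2), of k "D i j"]
      by (simp_all add: smooth_on_open[OF o(2)])
    then have "Ck_on k (\<lambda>z. relax_A0 \<iota> a0 D (fst z)) (\<Omega> \<times> (UNIV :: real set))" for k
      unfolding relax_A0_def
      by (intro Ck_on_block_mat Ck_on_w_symmetrizer Ck_on_const S assms(10)) (auto simp: inO)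
    then show "smooth_on (\<Omega> \<times> {0..1}) (\<lambda>(U, \<epsilon>::real). relax_A0 \<iota> a0 D U)"
      by (intro smooth_on_case_prodI[where f = "\<lambda>U _. relax_A0 \<iota> a0 D U"] o)
    show "sym_pos_def (relax_A0 \<iota> a0 D U)" if "U \<in> \<Omega>" for U
      unfolding relax_A0_def
      by (rule sym_pos_def_block_diag[OF assms(7) M(1)[unfolded M_def]]) (rule inO[OF that])+
    show "relax_A0 \<iota> a0 D U ** relax_A \<iota> a D j U \<epsilon> = transpose (relax_A \<iota> a D j U \<epsilon>) ** relax_A0 \<iota> a0 D U"
      if "U \<in> \<Omega>" for U \<epsilon> j
      by (rule relax_A0_symmetrizes[OF refl sym(2) assms(8) sym(1)[unfolded M_def] M(2)[unfolded M_def]])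
         (rule inO[OF that])+
    fix u assume u: "u \<in> \<Omega>u"
    show "sym_pos_def (2 *\<^sub>R M u)"
      using M(1)[OF u] by (simp add: sym_pos_def_def transpose_scalar scaleR_matrix_vector_assoc[symmetric])
    have "M u ** (- mat 1) = - M u" "transpose (- mat 1) ** M u = - M u"
      using matrix_mult_scaleR(1)[of "M u" "-1" "mat 1"] matrix_mult_scaleR(2)[of "-1" "mat 1" "M u"]
        transpose_scalar[of "-1" "mat 1 :: real^('d \<times> 's)^('d \<times> 's)"] by simp_all
    then have "relax_A0 \<iota> a0 D (join u 0) ** block_mat 0 0 0 (- mat 1)
        + transpose (block_mat 0 0 0 (- mat 1)) ** relax_A0 \<iota> a0 D (join u 0) = - block_mat 0 0 0 (2 *\<^sub>R M u)"
      by (simp add: relax_A0_def M_def[symmetric] transpose_block_mat block_mat_mult)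
         (simp add: vec_eq_sum_iff)
    \<comment> \<open>Both sides coincide, so the difference in \<open>loewner_le\<close> is the
      zero matrix.\<close>
    then show "let J = jacobian (\<lambda>U. relax_Q U 0) (at (join u 0)) in
        loewner_le (relax_A0 \<iota> a0 D (join u 0) ** J + transpose J ** relax_A0 \<iota> a0 D (join u 0))
          (- block_mat 0 0 0 (2 *\<^sub>R M u))"
      unfolding relax_Q_eq jacobian_matrix_mult Let_def
      by (simp add: loewner_le_def sym_pos_semidef_def)
    \<comment> \<open>At \<epsilon> = 0 the block \<open>\<epsilon> *\<^sub>R a j\<close> vanishes
      for every \<open>v\<close>, so the function differentiated in (v) is identically zero.\<close>
    have "block11 (relax_A \<iota> a D j (join v 0) 0) = 0" for j v
      by (simp add: block11_def relax_A_def vec_eq_iff)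
    then show "block11 (relax_A \<iota> a D j (join u 0) 0) = 0"
      "((\<lambda>v. block11 (relax_A \<iota> a D j (join v 0) 0)) has_derivative (\<lambda>_. 0)) (at u)" for j
      by simp_all
  qed
qed

end
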